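(* Let $(S,s)$ be a finite bijective set-theoretic solution to the Pentagon Equation and write $s(x,y)=(x\cdot y,\theta_x(y))$. Then the map $\theta_x:S\to S$ is bijective for every $x\in S$.
   Context: A set-theoretic solution to the Pentagon Equation is a pair $(S,s)$ with $S$ a nonempty set and $s:S\times S\to S\times S$ a map such that $s_{23}s_{13}s_{12}=s_{12}s_{23}$ on $S\times S\times S$, where $s_{12}=s\times\mathrm{id}$, $s_{23}=\mathrm{id}\times s$, $s_{13}=(\tau\times\mathrm{id})(\mathrm{id}\times s)(\tau\times\mathrm{id})$ and $\tau(x,y)=(y,x)$. It is finite if $S$ is finite, and bijective if $s$ is bijective. *)

theory Defs
  imports Main "HOL-Library.FuncSet"
begin

text \<open>Triples in \<open>S \<times> S \<times> S\<close> are right-nested pairs, so \<open>s \<times> id\<close> needs an explicit reassociation.\<close>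

definition on_12 :: "('a \<times> 'a \<Rightarrow> 'a \<times> 'a) \<Rightarrow> 'a \<times> 'a \<times> 'a \<Rightarrow> 'a \<times> 'a \<times> 'a" where
  "on_12 s = (\<lambda>(x, y, z). case s (x, y) of (u, v) \<Rightarrow> (u, v, z))"

definition on_23 :: "('a \<times> 'a \<Rightarrow> 'a \<times> 'a) \<Rightarrow> 'a \<times> 'a \<times> 'a \<Rightarrow> 'a \<times> 'a \<times> 'a" where
  "on_23 s = map_prod id s"

definition on_13 :: "('a \<times> 'a \<Rightarrow> 'a \<times> 'a) \<Rightarrow> 'a \<times> 'a \<times> 'a \<Rightarrow> 'a \<times> 'a \<times> 'a" where
  "on_13 s = on_12 prod.swap \<circ> on_23 s \<circ> on_12 prod.swap"

text \<open>Juxtaposition in the equation \<open>s\<^sub>2\<^sub>3 s\<^sub>1\<^sub>3 s\<^sub>1\<^sub>2 = s\<^sub>1\<^sub>2 s\<^sub>2\<^sub>3\<close> is composition of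
  functions, the rightmost map acting first. Values of \<open>s\<close> outside \<open>S \<times> S\<close> are irrelevant.\<close>

definition pentagon_solution :: "'a set \<Rightarrow> ('a \<times> 'a \<Rightarrow> 'a \<times> 'a) \<Rightarrow> bool" where
  "pentagon_solution S s \<longleftrightarrow>
     S \<noteq> {} \<and> s \<in> S \<times> S \<rightarrow> S \<times> S \<and>
     (\<forall>t \<in> S \<times> S \<times> S. (on_23 s \<circ> on_13 s \<circ> on_12 s) t = (on_12 s \<circ> on_23 s) t)"

end

theory Submission
  imports Defs
begin

text \<open>Besides associativity, only the identity \<open>\<theta>\<^sub>x(yz) = \<theta>\<^sub>x(y) \<theta>\<^sub>x\<^sub>y(z)\<close> of the pentagon equation is
  needed. A right ideal \<open>I\<close> satisfies \<open>s(I \<times> S) \<subseteq> I \<times> S\<close>, hence equality by finiteness, so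
  \<open>xy \<in> I\<close> forces \<open>x \<in> I\<close>. With \<open>I = xyS\<close> this gives \<open>xyS = xS \<ni> x\<close>, so principal right ideals
  partition \<open>S\<close> and left multiplication is injective on each of them. Now let \<open>yS = y'S\<close>,
  \<open>\<theta>\<^sub>x(y) = \<theta>\<^sub>x(y')\<close>, and let \<open>\<theta>\<^sub>x\<^sub>y(z)\<close>, \<open>\<theta>\<^sub>x\<^sub>y\<^sub>'(z')\<close> generate the same right ideal. Replacing \<open>z\<close>
  inside \<open>zS\<close> we may assume \<open>yz = y'z'\<close>; cancelling \<open>\<theta>\<^sub>x(y)\<close> in the identity and using injectivity
  of \<open>s\<close> gives \<open>y = y'\<close> and \<open>z = z'\<close>. With \<open>y = y'\<close> this says that every \<open>\<theta>\<^sub>u\<close> induces an injective,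
  hence surjective, map on principal right ideals. So suitable \<open>z\<close>, \<open>z'\<close> exist for any \<open>y\<close>, \<open>y'\<close>, and
  \<open>\<theta>\<^sub>x\<close> is injective.\<close>

locale finite_bijective_pentagon =
  fixes S :: "'a set"
    and s :: "'a \<times> 'a \<Rightarrow> 'a \<times> 'a"
    and mult :: "'a \<Rightarrow> 'a \<Rightarrow> 'a" (infixl "\<cdot>" 70)
    and \<theta> :: "'a \<Rightarrow> 'a \<Rightarrow> 'a"
  assumes pentagon: "pentagon_solution S s"
    and finite_S: "finite S"
    and bij_s: "bij_betw s (S \<times> S) (S \<times> S)"
    and s_eq: "\<And>x y. x \<in> S \<Longrightarrow> y \<in> S \<Longrightarrow> s (x, y) = (x \<cdot> y, \<theta> x y)"
begin

lemma mult_closed: "x \<in> S \<Longrightarrow> y \<in> S \<Longrightarrow> x \<cdot> y \<in> S"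
  and theta_closed: "x \<in> S \<Longrightarrow> y \<in> S \<Longrightarrow> \<theta> x y \<in> S"
  using bij_betw_apply[OF bij_s, of "(x, y)"] s_eq by simp_all

lemma pentagon_components:
  assumes "x \<in> S" "y \<in> S" "z \<in> S"
  shows mult_assoc: "x \<cdot> y \<cdot> z = x \<cdot> (y \<cdot> z)"
    and theta_mult: "\<theta> x (y \<cdot> z) = \<theta> x y \<cdot> \<theta> (x \<cdot> y) z"
proof -
  have "(on_23 s \<circ> on_13 s \<circ> on_12 s) (x, y, z) = (on_12 s \<circ> on_23 s) (x, y, z)"
    using pentagon assms unfolding pentagon_solution_def by blast
  then show "x \<cdot> y \<cdot> z = x \<cdot> (y \<cdot> z)" "\<theta> x (y \<cdot> z) = \<theta> x y \<cdot> \<theta> (x \<cdot> y) z"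
    using assms
    by (simp_all add: on_12_def on_13_def on_23_def s_eq mult_closed theta_closed)
qed

lemma s_cancel:
  assumes "x \<in> S" "y \<in> S" "x' \<in> S" "y' \<in> S" "x \<cdot> y = x' \<cdot> y'" "\<theta> x y = \<theta> x' y'"
  shows "x = x'" "y = y'"
  using inj_onD[OF bij_betw_imp_inj_on[OF bij_s], of "(x, y)" "(x', y')"] assms s_eq by auto

lemma right_ideal_prime:
  assumes "I \<subseteq> S" and ideal: "\<And>a b. a \<in> I \<Longrightarrow> b \<in> S \<Longrightarrow> a \<cdot> b \<in> I"
    and "x \<in> S" "y \<in> S" "x \<cdot> y \<in> I"
  shows "x \<in> I"
proof -
  have inj: "inj_on s (I \<times> S)"
    using bij_betw_imp_inj_on[OF bij_s] by (rule inj_on_subset) (use \<open>I \<subseteq> S\<close> in auto)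
  have "s ` (I \<times> S) \<subseteq> I \<times> S"
  proof (rule image_subsetI)
    fix p assume "p \<in> I \<times> S"
    then show "s p \<in> I \<times> S"
      using \<open>I \<subseteq> S\<close> by (cases p) (simp add: s_eq ideal theta_closed subsetD)
  qed
  moreover have "finite (I \<times> S)"
    using finite_S \<open>I \<subseteq> S\<close> finite_subset by blast
  ultimately have "s ` (I \<times> S) = I \<times> S"
    using inj by (simp add: endo_inj_surj)
  \<comment> \<open>The first component is \<open>x \<cdot> y\<close>, so this value has a preimage
    in \<open>I \<times> S\<close>, which injectivity of \<open>s\<close> identifies with
    \<open>(x, y)\<close>.\<close>
  moreover have "s (x, y) \<in> I \<times> S"
    using assms by (simp add: s_eq theta_closed)
  ultimately have "s (x, y) \<in> s ` (I \<times> S)"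
    by simp
  then obtain a b where ab: "a \<in> I" "b \<in> S" "s (x, y) = s (a, b)"
    by blast
  then have "x = a"
    using s_cancel(1)[of x y a b] assms s_eq by auto
  then show ?thesis using ab by simp
qed

definition right_ideal :: "'a \<Rightarrow> 'a set" where
  "right_ideal x = (\<cdot>) x ` S"

lemma right_ideal_subset: "x \<in> S \<Longrightarrow> right_ideal x \<subseteq> S"
  by (auto simp: right_ideal_def mult_closed)

lemma right_ideal_mult_closed:
  "x \<in> S \<Longrightarrow> a \<in> right_ideal x \<Longrightarrow> b \<in> S \<Longrightarrow> a \<cdot> b \<in> right_ideal x"
  by (auto simp: right_ideal_def mult_assoc mult_closed)

lemma mem_right_ideal_mult:
  assumes "x \<in> S" "y \<in> S"
  shows "x \<in> right_ideal (x \<cdot> y)"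
proof -
  have xy: "x \<cdot> y \<in> S" using assms by (rule mult_closed)
  note prime = right_ideal_prime[OF right_ideal_subset[OF xy] right_ideal_mult_closed[OF xy]]
  \<comment> \<open>Primality is used twice: \<open>x \<cdot> y \<cdot> x\<close> is in the ideal,
    hence so is \<open>x \<cdot> y\<close>, hence so is \<open>x\<close>.\<close>
  have "x \<cdot> y \<in> right_ideal (x \<cdot> y)"
    by (rule prime[of _ x]) (use xy assms in \<open>auto simp: right_ideal_def\<close>)
  then show ?thesis
    by (rule prime[rotated -1]) (use assms in auto)
qed

lemma right_ideal_mult:
  assumes "x \<in> S" "y \<in> S"
  shows "right_ideal (x \<cdot> y) = right_ideal x"
proof
  show "right_ideal (x \<cdot> y) \<subseteq> right_ideal x"
    using assms by (auto simp: right_ideal_def mult_assoc mult_closed)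
  show "right_ideal x \<subseteq> right_ideal (x \<cdot> y)"
    using mem_right_ideal_mult[OF assms] right_ideal_mult_closed[of "x \<cdot> y" x] assms
    by (auto simp: right_ideal_def[of x] mult_closed)
qed

lemma mem_right_ideal_self: "x \<in> S \<Longrightarrow> x \<in> right_ideal x"
  using mem_right_ideal_mult right_ideal_mult by blast

text \<open>Multiplication by \<open>p\<close> moves \<open>right_ideal q\<close> into
  \<open>right_ideal p\<close>; a further multiplication by \<open>q\<close> brings it back. The
  composite is a surjective self-map of a finite set, hence injective.\<close>

lemma inj_on_mult_right_ideal:
  assumes "p \<in> S" "q \<in> S"
  shows "inj_on ((\<cdot>) p) (right_ideal q)"
proof -
  have "(\<lambda>x. q \<cdot> (p \<cdot> x)) ` right_ideal q = right_ideal (q \<cdot> (p \<cdot> q))"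
    using assms by (simp add: right_ideal_def image_image mult_assoc mult_closed)
  also have "\<dots> = right_ideal q"
    using assms by (simp add: right_ideal_mult mult_closed)
  finally have "inj_on (\<lambda>x. q \<cdot> (p \<cdot> x)) (right_ideal q)"
    using finite_S by (intro eq_card_imp_inj_on) (simp_all add: right_ideal_def)
  then show ?thesis
    by (auto simp: inj_on_def)
qed

lemma left_cancel:
  assumes "p \<in> S" "a \<in> S" "b \<in> S" "right_ideal a = right_ideal b" "p \<cdot> a = p \<cdot> b"
  shows "a = b"
  using inj_onD[OF inj_on_mult_right_ideal[of p a]] assms mem_right_ideal_self by metis

lemma theta_separation:
  assumes S: "x \<in> S" "y \<in> S" "y' \<in> S" "z \<in> S" "z' \<in> S"
    and yy': "right_ideal y = right_ideal y'" "\<theta> x y = \<theta> x y'"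
    and zz': "right_ideal (\<theta> (x \<cdot> y) z) = right_ideal (\<theta> (x \<cdot> y') z')"
  shows "y = y'" "right_ideal z = right_ideal z'"
proof -
  have "y' \<cdot> z' \<in> right_ideal (y \<cdot> z)"
    using S yy'(1) by (simp add: right_ideal_mult) (simp add: right_ideal_def)
  then obtain t where t: "t \<in> S" "y' \<cdot> z' = y \<cdot> z \<cdot> t"
    by (auto simp: right_ideal_def)
  define w where "w = z \<cdot> t"
  have w: "w \<in> S" "y \<cdot> w = y' \<cdot> z'" "right_ideal w = right_ideal z"
    using S t by (simp_all add: w_def mult_closed mult_assoc right_ideal_mult)
  have closed: "\<theta> x y \<in> S" "\<theta> (x \<cdot> y) w \<in> S" "\<theta> (x \<cdot> y') z' \<in> S" "x \<cdot> y \<in> S" "x \<cdot> y' \<in> S"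
    using S w(1) by (simp_all add: mult_closed theta_closed)
  \<comment> \<open>Since \<open>w = z \<cdot> t\<close>, \<open>theta_mult\<close> makes
    \<open>\<theta> (x \<cdot> y) w\<close> a right multiple of
    \<open>\<theta> (x \<cdot> y) z\<close>.\<close>
  have "right_ideal (\<theta> (x \<cdot> y) w) = right_ideal (\<theta> (x \<cdot> y) z)"
    using S t by (simp add: w_def theta_mult mult_closed theta_closed right_ideal_mult)
  then have "right_ideal (\<theta> (x \<cdot> y) w) = right_ideal (\<theta> (x \<cdot> y') z')"
    using zz' by (rule trans)
  \<comment> \<open>Both sides are \<open>\<theta> x\<close> of the common product
    \<open>y \<cdot> w = y' \<cdot> z'\<close>.\<close>
  moreover have "\<theta> x y \<cdot> \<theta> (x \<cdot> y) w = \<theta> x y \<cdot> \<theta> (x \<cdot> y') z'"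
    using S w yy'(2) by (metis theta_mult)
  ultimately have theta_eq: "\<theta> (x \<cdot> y) w = \<theta> (x \<cdot> y') z'"
    by (rule left_cancel[OF closed(1-3)])
  have mult_eq: "x \<cdot> y \<cdot> w = x \<cdot> y' \<cdot> z'"
    using S w(1,2) by (simp add: mult_assoc)
  have "x \<cdot> y = x \<cdot> y'"
    by (rule s_cancel(1)[OF closed(4) w(1) closed(5) S(5) mult_eq theta_eq])
  then show "y = y'"
    by (rule left_cancel[OF S(1-3) yy'(1)])
  have "w = z'"
    by (rule s_cancel(2)[OF closed(4) w(1) closed(5) S(5) mult_eq theta_eq])
  then show "right_ideal z = right_ideal z'"
    using w(3) by simp
qed

lemma theta_reflects_right_ideal:
  assumes "u \<in> S" "z \<in> S" "z' \<in> S" "right_ideal (\<theta> u z) = right_ideal (\<theta> u z')"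
  shows "right_ideal z = right_ideal z'"
proof -
  \<comment> \<open>A right unit \<open>v\<close> for \<open>u\<close> lets
    \<open>theta_separation\<close> be applied with both middle elements equal to \<open>v\<close>,
    so that \<open>x \<cdot> y\<close> becomes \<open>u\<close>.\<close>
  obtain v where "v \<in> S" "u = u \<cdot> v"
    using mem_right_ideal_self[OF assms(1)] by (auto simp: right_ideal_def)
  then show ?thesis
    using theta_separation(2)[of u v v z z'] assms by simp
qed

lemma theta_meets_right_ideal:
  assumes "u \<in> S" "c \<in> S"
  obtains z where "z \<in> S" "right_ideal (\<theta> u z) = right_ideal c"
proof -
  \<comment> \<open>Choosing a generator of each ideal makes \<open>?f\<close> a function without
    first showing independence of the generator.\<close>
  let ?E = "right_ideal ` S" and ?r = "inv_into S right_ideal"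
  let ?f = "\<lambda>X. right_ideal (\<theta> u (?r X))"
  have r: "?r X \<in> S" "right_ideal (?r X) = X" if "X \<in> ?E" for X
    using that by (simp_all add: inv_into_into f_inv_into_f)
  have "?f ` ?E \<subseteq> ?E"
    using r(1) assms(1) by (blast intro: theta_closed)
  moreover have "inj_on ?f ?E"
    by (rule inj_onI) (metis r assms(1) theta_reflects_right_ideal)
  ultimately have "?f ` ?E = ?E"
    using finite_S by (intro endo_inj_surj) auto
  then obtain X where "X \<in> ?E" "right_ideal c = ?f X"
    using assms(2) by (metis (no_types, lifting) imageE imageI)
  then show ?thesis
    using that[of "?r X"] r(1) by simp
qed

lemma inj_on_theta:
  assumes x: "x \<in> S"
  shows "inj_on (\<theta> x) S"
proof (rule inj_onI)
  fix y y' assume y: "y \<in> S" "y' \<in> S" "\<theta> x y = \<theta> x y'"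
  \<comment> \<open>The argument \<open>y\<close> on the right is an arbitrary choice of
    \<open>z'\<close>.\<close>
  obtain z where "z \<in> S" "right_ideal (\<theta> (x \<cdot> y) z) = right_ideal (\<theta> (x \<cdot> y') y)"
    using theta_meets_right_ideal[of "x \<cdot> y" "\<theta> (x \<cdot> y') y"] x y
    by (auto simp: mult_closed theta_closed)
  moreover have "right_ideal y = right_ideal y'"
    using theta_reflects_right_ideal[of x y y'] x y by simp
  ultimately show "y = y'"
    using theta_separation(1)[of x y y' z y] x y by simp
qed

lemma bij_betw_theta: "x \<in> S \<Longrightarrow> bij_betw (\<theta> x) S S"
  by (simp add: bij_betw_def inj_on_theta endo_inj_surj finite_S theta_closed image_subset_iff)

end

theorem proposition2p9:
  fixes S :: "'a set"
    and s :: "'a \<times> 'a \<Rightarrow> 'a \<times> 'a"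
    and mult :: "'a \<Rightarrow> 'a \<Rightarrow> 'a"
    and \<theta> :: "'a \<Rightarrow> 'a \<Rightarrow> 'a"
  assumes "pentagon_solution S s"
    and "finite S"
    and "bij_betw s (S \<times> S) (S \<times> S)"
    and "\<And>x y. x \<in> S \<Longrightarrow> y \<in> S \<Longrightarrow> s (x, y) = (mult x y, \<theta> x y)"
  shows "\<forall>x \<in> S. bij_betw (\<theta> x) S S"
proof -
  interpret finite_bijective_pentagon S s mult \<theta>
    using assms by unfold_locales
  show ?thesis
    by (blast intro: bij_betw_theta)
qed

end
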